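(* Let $p$ be an odd prime and $n\geq p$. Then $$\chi(\Theta(\operatorname{Cube}(n,n-2)))\equiv 1 \mod p.$$
   Context: A hypergraph $\mathcal H=(V,H)$ is a nonempty set $V$ of vertices with a collection $H$ of subsets of $V$, called hyperedges. $\Theta(\mathcal H)$ is the simplicial complex whose simplices are the (nonempty) finite subsets of complements $V\setminus h$ of hyperedges $h\in H$. $\operatorname{Cube}(n,k)$ is the hypergraph whose vertices are the vertices of the $n$-cube and whose hyperedges are the sets of vertices spanning $k$-dimensional faces of the $n$-cube. $\chi$ denotes the (unreduced) Euler characteristic. *)

theory Defs
  imports "HOL-Analysis.Analysis" "HOL-Number_Theory.Cong"
begin

type_synonym 'a hypergraph = "'a set \<times> 'a set set"

definition is_hypergraph :: "'a hypergraph \<Rightarrow> bool" where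
  "is_hypergraph \<H> \<longleftrightarrow> (case \<H> of (V, H) \<Rightarrow> V \<noteq> {} \<and> H \<subseteq> Pow V)"

text \<open>An abstract simplicial complex is represented by the set of its nonempty simplices.\<close>

definition Theta :: "'a hypergraph \<Rightarrow> 'a set set" where
  "Theta \<H> = (case \<H> of (V, H) \<Rightarrow>
     {\<sigma>. \<sigma> \<noteq> {} \<and> finite \<sigma> \<and> (\<exists>h\<in>H. \<sigma> \<subseteq> V - h)})"

text \<open>
  Unreduced Euler characteristic of a finite complex whose simplices are all nonempty:
  a simplex \<open>\<sigma>\<close> has dimension \<open>card \<sigma> - 1\<close>.
\<close>

definition euler_char :: "'a set set \<Rightarrow> int" where
  "euler_char K = (\<Sum>\<sigma>\<in>K. (-1) ^ (card \<sigma> - 1))"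

text \<open>
  The dimension of the cube is the number of elements of the index type \<open>'n\<close>: the
  \<open>n\<close>-cube is the polytope \<open>[0,1]\<^sup>n\<close> in \<open>real ^ 'n\<close>. A set of vertices spans a face
  if its convex hull is that face.
\<close>

definition unit_cube :: "(real ^ 'n::finite) set" where
  "unit_cube = cbox 0 1"

definition cube_vertices :: "(real ^ 'n::finite) set" where
  "cube_vertices = {v. v extreme_point_of unit_cube}"

definition Cube :: "'n::finite itself \<Rightarrow> nat \<Rightarrow> (real ^ 'n) hypergraph" where
  "Cube _ k = (cube_vertices,
     {h. h \<subseteq> cube_vertices \<and> convex hull h face_of unit_cube
         \<and> aff_dim (convex hull h) = int k})"

lemma finite_cube_vertices: "finite cube_vertices"
  unfolding cube_vertices_def unit_cube_def
  by (intro finite_polyhedron_extreme_points polyhedron_interval)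

lemma zero_in_cube_vertices: "(0 :: real ^ 'n::finite) \<in> cube_vertices"
proof -
  have False
    if ab: "a \<in> cbox 0 1" "b \<in> cbox 0 1" and seg: "0 \<in> open_segment a b" for a b :: "real ^ 'n"
  proof -
    obtain u where "a \<noteq> b" and u: "0 < u" "u < 1" and eq: "0 = (1 - u) *\<^sub>R a + u *\<^sub>R b"
      using seg by (auto simp: in_segment)
    have "a $ i = 0 \<and> b $ i = 0" for i
    proof -
      have "0 \<le> a $ i" "0 \<le> b $ i" using ab by (auto simp: mem_box_cart)
      moreover have "(1 - u) * a $ i + u * b $ i = 0"
        using arg_cong[OF eq, of "\<lambda>x. x $ i"] by simp
      ultimately show ?thesis
        using u by (simp add: add_nonneg_eq_0_iff)
    qed
    then show ?thesis using \<open>a \<noteq> b\<close> by (simp add: vec_eq_iff)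
  qed
  moreover have "(0 :: real ^ 'n) \<in> cbox 0 1" by (simp add: mem_box_cart)
  ultimately show ?thesis
    unfolding cube_vertices_def unit_cube_def extreme_point_of_def
    by blast
qed

lemma is_hypergraph_Cube: "is_hypergraph (Cube TYPE('n::finite) k)"
  using zero_in_cube_vertices[where 'n = 'n] by (auto simp: is_hypergraph_def Cube_def)

lemma finite_Theta_Cube: "finite (Theta (Cube TYPE('n::finite) k))"
  by (rule finite_subset[of _ "Pow cube_vertices"])
     (auto simp: Theta_def Cube_def finite_cube_vertices)

end

theory Submission
  imports Defs "HOL-Combinatorics.Cycles"
begin

text \<open>
  Call the faces of codimension \<open>2\<close> of the cube its ridges. By inclusion--exclusion
  (\<open>euler_char_Theta_conv_covers\<close>), the Euler characteristic is \<open>1\<close> plus the sum of \<open>(-1) ^ card S\<close>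
  over all sets \<open>S\<close> of ridges that cover the vertices of the cube. A ridge fixes two
  coordinates (\<open>Cube_hyperedges\<close>); its vertices are the truth assignments that falsify a clause with
  two literals, so a cover is an unsatisfiable 2-CNF formula. It remains to show that these formulas,
  counted with sign, cancel modulo \<open>p\<close>.

  Since \<open>n \<ge> p\<close>, there is a permutation \<open>\<pi>\<close> of the coordinates that rotates \<open>p\<close> of them cyclically
  and fixes the others. It acts on the covers with period \<open>p\<close>, so that modulo \<open>p\<close> only the invariant
  covers count (\<open>sum_cong_sum_fixpoints\<close>). These cancel exactly. The satisfying assignments of a 2-CNF
  formula are closed under majority votes of an odd number of assignments, because any two majorities
  overlap (\<open>majority_in_vertex_face\<close>). If an invariant formula is satisfiable, the majority vote of
  the orbit of a solution is a solution that is constant on the rotated coordinates. Such an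
  assignment satisfies all \<open>p\<close> clauses \<open>x\<^sub>i \<or> \<not> x\<^bsub>\<pi> i\<^esub>\<close>, where \<open>i\<close> is a rotated coordinate. Hence
  adding or deleting this whole orbit of clauses does not affect satisfiability
  (\<open>covers_if_covers_with_ascents\<close>), and as \<open>p\<close> is odd it changes the sign
  (\<open>sum_invariant_covers_eq_0\<close>).
\<close>

section \<open>Alternating sums over covers\<close>

lemma sum_Pow_minus_one_power_card:
  assumes "finite A"
  shows "(\<Sum>X\<in>Pow A. (-1) ^ card X) = (of_bool (A = {}) :: int)"
  using prod_diff_conv_sum[OF assms, of "\<lambda>_. 1 :: int" "\<lambda>_. 1", symmetric] assms
  by (simp add: power_0_left)

text \<open>
  Inclusion--exclusion on both sides of the incidence between simplices and hyperedges. A set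
  \<open>\<sigma>\<close> of vertices misses some hyperedge unless the alternating sum over all sets \<open>S\<close> of hyperedges
  missed by \<open>\<sigma>\<close> is \<open>1\<close>. After exchanging the two sums, the inner sum runs over all subsets of
  \<open>V - \<Union>S\<close>, so that it vanishes unless \<open>S\<close> covers \<open>V\<close>. The leading \<open>1\<close> comes from the empty set:
  it misses every hyperedge, but is not a simplex.
\<close>

lemma euler_char_Theta_conv_covers:
  fixes V :: "'a set"
  assumes "finite V" "V \<noteq> {}" "H \<subseteq> Pow V" "H \<noteq> {}"
  shows "euler_char (Theta (V, H)) = 1 + (\<Sum>S | S \<subseteq> H \<and> \<Union>S = V. (-1) ^ card S)"
proof -
  have fin_H: "finite H"
    using assms(1,3) by (meson finite_Pow_iff finite_subset)
  let ?miss = "\<lambda>\<sigma>. {h \<in> H. \<sigma> \<inter> h = {}}"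
  have Theta_eq: "Theta (V, H) = {\<sigma> \<in> Pow V. ?miss \<sigma> \<noteq> {}} - {{}}"
    using assms(1) by (auto simp: Theta_def intro: finite_subset)
  have "(-1) ^ (card \<sigma> - 1) = - ((-1) ^ card \<sigma> :: int)" if "\<sigma> \<in> Theta (V, H)" for \<sigma>
  proof -
    have "card \<sigma> \<noteq> 0" using that by (auto simp: Theta_def)
    then show ?thesis by (cases "card \<sigma>") auto
  qed
  then have "euler_char (Theta (V, H)) = - (\<Sum>\<sigma>\<in>Theta (V, H). (-1) ^ card \<sigma>)"
    by (simp add: euler_char_def sum_negf)
  also have "\<dots> = 1 - (\<Sum>\<sigma> | \<sigma> \<in> Pow V \<and> ?miss \<sigma> \<noteq> {}. (-1) ^ card \<sigma>)"
    unfolding Theta_eq using assms(1,4) by (subst sum_diff) auto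
  also have "(\<Sum>\<sigma> | \<sigma> \<in> Pow V \<and> ?miss \<sigma> \<noteq> {}. (-1) ^ card \<sigma>) =
      (\<Sum>\<sigma>\<in>Pow V. (-1) ^ card \<sigma> * (1 - of_bool (?miss \<sigma> = {})) :: int)"
    by (rule sum.mono_neutral_cong_left) (use assms(1) in auto)
  also have "\<dots> = - (\<Sum>\<sigma>\<in>Pow V. (-1) ^ card \<sigma> * of_bool (?miss \<sigma> = {}))"
    using sum_Pow_minus_one_power_card[OF assms(1)] assms(2)
    by (simp add: algebra_simps sum_subtractf)
  also have "(\<Sum>\<sigma>\<in>Pow V. (-1) ^ card \<sigma> * of_bool (?miss \<sigma> = {}) :: int) =
      (\<Sum>\<sigma>\<in>Pow V. \<Sum>S | S \<in> Pow H \<and> S \<subseteq> ?miss \<sigma>. (-1) ^ card S * (-1) ^ card \<sigma>)"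
  proof (rule sum.cong[OF refl])
    fix \<sigma>
    have "{S. S \<in> Pow H \<and> S \<subseteq> ?miss \<sigma>} = Pow (?miss \<sigma>)" by auto
    then show "(-1) ^ card \<sigma> * of_bool (?miss \<sigma> = {}) =
        (\<Sum>S | S \<in> Pow H \<and> S \<subseteq> ?miss \<sigma>. (-1) ^ card S * (-1) ^ card \<sigma> :: int)"
      using sum_Pow_minus_one_power_card[of "?miss \<sigma>"] fin_H
      by (simp flip: sum_distrib_right)
  qed
  also have "\<dots> = (\<Sum>S\<in>Pow H. \<Sum>\<sigma> | \<sigma> \<in> Pow V \<and> S \<subseteq> ?miss \<sigma>. (-1) ^ card S * (-1) ^ card \<sigma>)"
    using assms(1) fin_H by (intro sum.swap_restrict) auto
  also have "\<dots> = (\<Sum>S\<in>Pow H. (-1) ^ card S * of_bool (\<Union>S = V))"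
  proof (rule sum.cong[OF refl])
    fix S assume S: "S \<in> Pow H"
    then have "{\<sigma>. \<sigma> \<in> Pow V \<and> S \<subseteq> ?miss \<sigma>} = Pow (V - \<Union>S)" by blast
    moreover have "V - \<Union>S = {} \<longleftrightarrow> \<Union>S = V" using S assms(3) by blast
    ultimately show "(\<Sum>\<sigma> | \<sigma> \<in> Pow V \<and> S \<subseteq> ?miss \<sigma>. (-1) ^ card S * (-1) ^ card \<sigma>) =
        (-1) ^ card S * (of_bool (\<Union>S = V) :: int)"
      using sum_Pow_minus_one_power_card[of "V - \<Union>S"] assms(1)
      by (simp flip: sum_distrib_left)
  qed
  also have "\<dots> = (\<Sum>S | S \<subseteq> H \<and> \<Union>S = V. (-1) ^ card S)"
  proof (rule sum.mono_neutral_cong_right)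
  qed (use fin_H in auto)
  finally show ?thesis by simp
qed

section \<open>Fixed points of maps of prime period\<close>

text \<open>
  A point that is not fixed has an orbit of exactly \<open>p\<close> points, and such an orbit contributes
  a multiple of \<open>p\<close> to the sum of an invariant function; the orbits are removed one at a time.
\<close>

lemma sum_cong_sum_fixpoints:
  fixes w :: "'a \<Rightarrow> int"
  assumes p: "prime p" and "finite C" and "f ` C \<subseteq> C"
    and "\<And>x. x \<in> C \<Longrightarrow> (f ^^ p) x = x" and "\<And>x. x \<in> C \<Longrightarrow> w (f x) = w x"
  shows "[sum w C = sum w {x\<in>C. f x = x}] (mod int p)"
  using assms(2-)
proof (induction C rule: finite_psubset_induct)
  case (psubset C)
  have in_C: "(f ^^ k) x \<in> C" if "x \<in> C" for x k
    using that psubset.prems(1) by (induction k) auto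
  have pow_pow: "(f ^^ i) ((f ^^ j) x) = (f ^^ (i + j)) x" for i j x
    by (simp add: funpow_add)
  show ?case
  proof (cases "\<forall>x\<in>C. f x = x")
    case True
    then have "{x\<in>C. f x = x} = C" by auto
    then show ?thesis by simp
  next
    case False
    then obtain x where x: "x \<in> C" "f x \<noteq> x" by auto
    have px: "(f ^^ p) x = x" using psubset.prems(2) x by simp
    have back_one: "(f ^^ (p - 1)) (f y) = y" if "y \<in> C" for y
      using psubset.prems(2)[OF that] prime_gt_0_nat[OF p]
      by (metis One_nat_def Suc_pred comp_apply funpow_Suc_right)
    \<comment> \<open>The period of \<open>x\<close> divides the prime \<open>p\<close> and is not \<open>1\<close>.\<close>
    have period: "least_power f x = p"
    proof -
      have "least_power f x \<noteq> 1"
        using least_powerI(1)[OF px] prime_gt_0_nat[OF p] x(2) by auto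
      then show ?thesis
        using least_power_minimal[OF px] p by (auto simp: prime_nat_iff)
    qed
    define Orb where "Orb = (\<lambda>i. (f ^^ i) x) ` {..<p}"
    have inj: "inj_on (\<lambda>i. (f ^^ i) x) {..<p}"
    proof (rule linorder_inj_onI)
      fix i j assume ij: "i < j" "i \<in> {..<p}" "j \<in> {..<p}"
      show "(f ^^ i) x \<noteq> (f ^^ j) x"
      proof
        assume eq: "(f ^^ i) x = (f ^^ j) x"
        have "(f ^^ (j - i)) x = (f ^^ (j - i)) ((f ^^ p) x)" by (simp add: px)
        also have "\<dots> = (f ^^ (p - i)) ((f ^^ j) x)"
          using ij by (simp add: pow_pow add.commute)
        also have "\<dots> = (f ^^ (p - i)) ((f ^^ i) x)"
          by (simp add: eq)
        also have "\<dots> = x"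
          using ij px by (simp add: pow_pow)
        finally have "p dvd j - i"
          using least_power_minimal[of "j - i" f x] period by simp
        then show False using ij by (auto dest: dvd_imp_le)
      qed
    qed auto
    have O_sub: "Orb \<subseteq> C" using x in_C by (auto simp: Orb_def)
    have mem_O: "(f ^^ k) x \<in> Orb" for k
      using funpow_mod_eq[OF px, of k] prime_gt_0_nat[OF p]
      by (metis Orb_def image_eqI lessThan_iff mod_less_divisor)
    have w_iter: "w ((f ^^ k) x) = w x" for k
      using x in_C psubset.prems(3) by (induction k) auto
    have sum_O: "sum w Orb = int p * w x"
      unfolding Orb_def by (subst sum.reindex[OF inj]) (simp add: w_iter)
    have O_moved: "f y \<noteq> y" if y: "y \<in> Orb" for y
    proof
      assume fy: "f y = y"
      obtain i where i: "i < p" "y = (f ^^ i) x" using y by (auto simp: Orb_def)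
      have "(f ^^ k) y = y" for k by (induction k) (auto simp: fy)
      then have "y = (f ^^ (p - i)) ((f ^^ i) x)" using i by simp
      also have "\<dots> = x" using i px by (simp add: pow_pow)
      finally show False using x fy by simp
    qed
    have "[sum w (C - Orb) = sum w {y \<in> C - Orb. f y = y}] (mod int p)"
    proof (rule psubset.IH)
      show "C - Orb \<subset> C" using mem_O[of 0] x by auto
      show "f ` (C - Orb) \<subseteq> C - Orb"
      proof clarsimp
        fix y assume y: "y \<in> C" "y \<notin> Orb"
        have "f y \<notin> Orb"
        proof
          assume "f y \<in> Orb"
          then obtain i where "f y = (f ^^ i) x" by (auto simp: Orb_def)
          then have "y = (f ^^ (p - 1 + i)) x" using back_one[OF y(1)] by (simp add: funpow_add)
          then show False using mem_O y by metis
        qed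
        then show "f y \<in> C \<and> f y \<notin> Orb" using psubset.prems(1) y by auto
      qed
    qed (use psubset.prems in auto)
    moreover have "{y \<in> C - Orb. f y = y} = {y \<in> C. f y = y}" using O_moved by auto
    moreover have "sum w C = sum w (C - Orb) + int p * w x"
      using sum.subset_diff[OF O_sub psubset.hyps, of w] sum_O by simp
    ultimately show ?thesis by (simp add: cong_def)
  qed
qed

section \<open>The faces of the cube\<close>

definition subcube :: "'n set \<Rightarrow> real ^ 'n \<Rightarrow> (real ^ 'n::finite) set" where
  "subcube J c = {x \<in> unit_cube. \<forall>i\<in>J. x $ i = c $ i}"

definition vertex_face :: "'n set \<Rightarrow> real ^ 'n \<Rightarrow> (real ^ 'n::finite) set" where
  "vertex_face J c = {v \<in> cube_vertices. \<forall>i\<in>J. v $ i = c $ i}"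

lemma mem_unit_cube: "x \<in> unit_cube \<longleftrightarrow> (\<forall>i. 0 \<le> x $ i \<and> x $ i \<le> 1)"
  by (simp add: unit_cube_def mem_box_cart)

lemma convex_unit_cube: "convex unit_cube"
  by (simp add: unit_cube_def)

lemma subcube_subset: "subcube J c \<subseteq> unit_cube"
  by (auto simp: subcube_def)

lemma zero_one_mem_unit_cube: "(\<And>i. c $ i \<in> {0, 1}) \<Longrightarrow> c \<in> unit_cube"
  unfolding mem_unit_cube by (metis insert_iff order.refl singletonD zero_le_one)

lemma subcube_face_of_unit_cube:
  fixes c :: "real ^ 'n::finite"
  assumes c: "\<And>i. c $ i \<in> {0, 1}"
  shows "subcube J c face_of unit_cube"
proof -
  have "convex (subcube J c)"
  proof (rule convexI)
    fix x y and u v :: real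
    assume *: "x \<in> subcube J c" "y \<in> subcube J c" "0 \<le> u" "0 \<le> v" "u + v = 1"
    then have "u *\<^sub>R x + v *\<^sub>R y \<in> unit_cube"
      by (intro convexD[OF convex_unit_cube]) (auto simp: subcube_def)
    then show "u *\<^sub>R x + v *\<^sub>R y \<in> subcube J c"
      using * by (simp add: subcube_def flip: distrib_right)
  qed
  moreover have "a \<in> subcube J c \<and> b \<in> subcube J c"
    if ab: "a \<in> unit_cube" "b \<in> unit_cube" and x: "x \<in> subcube J c" "x \<in> open_segment a b"
    for a b x
  proof -
    obtain u where u: "0 < u" "u < 1" and eq: "x = (1 - u) *\<^sub>R a + u *\<^sub>R b"
      using x(2) by (auto simp: in_segment)
    have "a $ i = c $ i \<and> b $ i = c $ i" if "i \<in> J" for i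
    proof -
      have bounds: "0 \<le> a $ i" "a $ i \<le> 1" "0 \<le> b $ i" "b $ i \<le> 1"
        using ab by (auto simp: mem_unit_cube)
      have sum: "(1 - u) * a $ i + u * b $ i = c $ i"
        using arg_cong[OF eq, of "\<lambda>x. x $ i"] x(1) that by (simp add: subcube_def)
      consider "c $ i = 0" | "c $ i = 1" using c[of i] by auto
      then show ?thesis
      proof cases
        case 1
        then show ?thesis using sum bounds u by (simp add: add_nonneg_eq_0_iff)
      next
        case 2
        have "(1 - u) * (1 - a $ i) + u * (1 - b $ i) = 0"
          using sum 2 by (simp add: algebra_simps)
        then show ?thesis using 2 bounds u by (simp add: add_nonneg_eq_0_iff)
      qed
    qed
    then show ?thesis using ab by (auto simp: subcube_def)
  qed
  ultimately show ?thesis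
    unfolding face_of_def by (blast intro: subcube_subset[THEN subsetD])
qed

text \<open>
  A face \<open>F\<close> fixes the coordinates that are constantly \<open>0\<close> or constantly \<open>1\<close> on it. Averaging
  points of \<open>F\<close> that witness the freedom of the other coordinates gives a point \<open>z\<close> of \<open>F\<close> all of
  whose free coordinates are strictly between \<open>0\<close> and \<open>1\<close>. Every other point of the subcube is
  the end of a segment in the cube that passes through \<open>z\<close>, and therefore belongs to \<open>F\<close>.
\<close>

lemma face_of_unit_cube_imp_subcube:
  fixes F :: "(real ^ 'n::finite) set"
  assumes F: "F face_of unit_cube" "F \<noteq> {}"
  obtains J c where "\<And>i. c $ i \<in> {0, 1}" "F = subcube J c"
proof -
  have sub: "F \<subseteq> unit_cube" and "convex F"
    using F by (auto simp: face_of_def)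
  define J0 where "J0 = {i. \<forall>x\<in>F. x $ i = 0}"
  define J1 where "J1 = {i. \<forall>x\<in>F. x $ i = 1}"
  define c :: "real ^ 'n" where "c = (\<chi> i. of_bool (i \<in> J1))"
  have c_J0: "c $ i = 0" if "i \<in> J0" for i
    using that F(2) by (auto simp: c_def J0_def J1_def)
  have c_J1: "c $ i = 1" if "i \<in> J1" for i
    using that by (simp add: c_def)
  let ?J = "J0 \<union> J1"
  have F_sub: "F \<subseteq> subcube ?J c"
    using sub c_J0 c_J1 by (auto simp: subcube_def J0_def J1_def)
  have "\<exists>x\<in>F. 0 < x $ i \<and> x $ i < 1" if i: "i \<notin> ?J" for i
  proof -
    obtain x y where xy: "x \<in> F" "x $ i \<noteq> 0" "y \<in> F" "y $ i \<noteq> 1"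
      using i by (auto simp: J0_def J1_def)
    have "(1/2) *\<^sub>R x + (1/2) *\<^sub>R y \<in> F"
      using convexD[OF \<open>convex F\<close> xy(1,3), of "1/2" "1/2"] by simp
    moreover have "0 < x $ i" "x $ i \<le> 1" "0 \<le> y $ i" "y $ i < 1"
      using xy sub by (auto simp: mem_unit_cube less_le)
    ultimately show ?thesis
      by (intro bexI[of _ "(1/2) *\<^sub>R x + (1/2) *\<^sub>R y"]) auto
  qed
  then obtain w where w: "\<And>i. i \<notin> ?J \<Longrightarrow> w i \<in> F \<and> 0 < w i $ i \<and> w i $ i < 1"
    by metis
  \<comment> \<open>\<open>x0\<close> fills the places of the fixed coordinates, so that the average is taken over all indices.\<close>
  obtain x0 where x0: "x0 \<in> F" using F(2) by auto
  define w' where "w' i = (if i \<in> ?J then x0 else w i)" for i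
  have w': "w' i \<in> F" for i using w x0 by (simp add: w'_def)
  define z where "z = (\<Sum>i\<in>UNIV. (1 / real CARD('n)) *\<^sub>R w' i)"
  have z: "z \<in> F"
    unfolding z_def using w' by (intro convex_sum \<open>convex F\<close>) auto
  have z_less: "0 < z $ i \<and> z $ i < 1" if i: "i \<notin> ?J" for i
  proof -
    have bound: "0 \<le> w' j $ i" "w' j $ i \<le> 1" for j
      using w'[of j] sub by (auto simp: mem_unit_cube)
    have strict: "0 < w' i $ i" "w' i $ i < 1" using w[OF i] i by (auto simp: w'_def)
    have z_i: "z $ i = (\<Sum>j\<in>UNIV. w' j $ i) / real CARD('n)"
      by (simp add: z_def sum_divide_distrib)
    have "0 < (\<Sum>j\<in>UNIV. w' j $ i)"
      using bound strict by (intro sum_pos2[of _ i]) auto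
    moreover have "(\<Sum>j\<in>UNIV. w' j $ i) < (\<Sum>j\<in>(UNIV::'n set). 1)"
      using bound strict by (intro sum_strict_mono_ex1) auto
    ultimately show ?thesis by (simp add: z_i field_simps)
  qed
  have "subcube ?J c \<subseteq> F"
  proof
    fix y assume y: "y \<in> subcube ?J c"
    show "y \<in> F"
    proof (cases "y = z")
      case False
      \<comment> \<open>The segment from \<open>y\<close> to \<open>z\<close> can be prolonged beyond \<open>z\<close> inside the cube.\<close>
      have "\<exists>e>0. \<forall>t. 0 < t \<and> t < e \<longrightarrow> 0 \<le> z $ i + t * (z $ i - y $ i) \<and> z $ i + t * (z $ i - y $ i) \<le> 1" for i
      proof (cases "i \<in> ?J")
        case True
        then have "z $ i = y $ i" using y z F_sub by (auto simp: subcube_def)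
        moreover have "0 \<le> z $ i" "z $ i \<le> 1" using z sub by (auto simp: mem_unit_cube)
        ultimately show ?thesis by (auto intro: exI[of _ 1])
      next
        case False
        have "((\<lambda>t. z $ i + t * (z $ i - y $ i)) \<longlongrightarrow> z $ i + 0 * (z $ i - y $ i)) (at_right 0)"
          by (intro tendsto_intros)
        then have lim: "((\<lambda>t. z $ i + t * (z $ i - y $ i)) \<longlongrightarrow> z $ i) (at_right 0)" by simp
        have "\<forall>\<^sub>F t in at_right 0. 0 < z $ i + t * (z $ i - y $ i) \<and> z $ i + t * (z $ i - y $ i) < 1"
          using order_tendstoD[OF lim] z_less[OF False] by (simp add: eventually_conj_iff)
        then show ?thesis by (auto simp: eventually_at_right_field intro: less_imp_le)
      qed
      then obtain e where e: "\<And>i. e i > 0"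
        "\<And>i t. 0 < t \<Longrightarrow> t < e i \<Longrightarrow> 0 \<le> z $ i + t * (z $ i - y $ i) \<and> z $ i + t * (z $ i - y $ i) \<le> 1"
        by metis
      define t where "t = Min (range e) / 2"
      have "Min (range e) > 0" using e(1) by simp
      then have "0 < t" "t < Min (range e)" by (auto simp: t_def)
      then have t: "0 < t" "t < e i" for i
        using Min_le[of "range e" "e i"] by auto
      define y' where "y' = z + t *\<^sub>R (z - y)"
      have y'_in: "y' \<in> unit_cube" using e(2)[OF t] by (simp add: mem_unit_cube y'_def)
      have "z \<in> open_segment y y'"
        unfolding in_segment
      proof (intro conjI exI[of _ "1 / (1 + t)"])
        have "y' - y = (1 + t) *\<^sub>R (z - y)" by (simp add: y'_def algebra_simps)
        then show "y \<noteq> y'" using False t(1) by auto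
        have "(1 + t) *\<^sub>R z = t *\<^sub>R y + y'" by (simp add: y'_def algebra_simps)
        then have "(1 / (1 + t)) *\<^sub>R ((1 + t) *\<^sub>R z) = (1 / (1 + t)) *\<^sub>R (t *\<^sub>R y + y')" by simp
        then have "z = (t / (1 + t)) *\<^sub>R y + (1 / (1 + t)) *\<^sub>R y'"
          using t(1) by (simp add: scaleR_add_right)
        moreover have "t / (1 + t) = 1 - 1 / (1 + t)" using t(1) by (simp add: field_simps)
        ultimately show "z = (1 - 1 / (1 + t)) *\<^sub>R y + (1 / (1 + t)) *\<^sub>R y'" by simp
      qed (use t(1) in auto)
      then show ?thesis
        using face_ofD[OF F(1) _ _ _ z] y y'_in by (auto simp: subcube_def)
    qed (use z in simp)
  qed
  then have "F = subcube ?J c" using F_sub by auto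
  then show ?thesis by (intro that[of c ?J]) (auto simp: c_def)
qed

text \<open>
  Translated by its vertex \<open>c\<close>, the subcube contains \<open>axis i 1\<close> up to sign for each free coordinate
  \<open>i\<close>, and hence spans the whole coordinate subspace of the free coordinates.
\<close>

lemma aff_dim_subcube:
  fixes c :: "real ^ 'n::finite"
  assumes c: "\<And>i. c $ i \<in> {0, 1}"
  shows "aff_dim (subcube J c) = int CARD('n) - int (card J)"
proof -
  let ?D = "(\<lambda>x. x - c) ` subcube J c"
  let ?W = "{x :: real ^ 'n. \<forall>i. i \<notin> - J \<longrightarrow> x $ i = 0}"
  have c_in: "c \<in> subcube J c"
    using zero_one_mem_unit_cube[OF c] by (simp add: subcube_def)
  then have dim: "aff_dim (subcube J c) = int (dim ?D)"
    by (intro aff_dim_eq_dim_subtract hull_inc)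
  have "span ?D = ?W"
  proof
    have "subspace ?W" by (auto simp: subspace_def)
    then show "span ?D \<subseteq> ?W"
      by (intro span_minimal) (auto simp: subcube_def)
    show "?W \<subseteq> span ?D"
    proof
      fix x assume x: "x \<in> ?W"
      have "axis i 1 \<in> span ?D" if i: "i \<notin> J" for i
      proof -
        \<comment> \<open>Flipping the free coordinate \<open>i\<close> of \<open>c\<close> stays in the subcube.\<close>
        have "c + (1 - 2 * c $ i) *\<^sub>R axis i 1 \<in> subcube J c"
          using c_in c[of i] i by (auto simp: subcube_def mem_unit_cube axis_def)
        then have "(1 - 2 * c $ i) *\<^sub>R axis i 1 \<in> span ?D"
          by (intro span_base) (auto intro: image_eqI[rotated])
        then have "(1 - 2 * c $ i) *\<^sub>R ((1 - 2 * c $ i) *\<^sub>R axis i 1) \<in> span ?D"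
          by (rule span_scale)
        moreover have "(1 - 2 * c $ i) * (1 - 2 * c $ i) = 1" using c[of i] by auto
        ultimately show ?thesis by simp
      qed
      have "(\<Sum>i\<in>UNIV. x $ i *s axis i 1) \<in> span ?D"
        proof (intro span_sum)
        fix i show "x $ i *s axis i 1 \<in> span ?D"
          using x \<open>\<And>i. i \<notin> J \<Longrightarrow> axis i 1 \<in> span ?D\<close>[of i]
          by (cases "i \<in> J") (auto simp: scalar_mult_eq_scaleR span_zero span_scale)
      qed
      then show "x \<in> span ?D" by (simp add: basis_expansion)
    qed
  qed
  then have "dim ?D = dim ?W" by (metis dim_span)
  also have "\<dots> = card (- J)"
    using dim_substandard_cart[of "- J", where 'a = real] by (simp add: dim_vec_eq)
  also have "\<dots> = CARD('n) - card J"
    by (simp add: Compl_eq_Diff_UNIV card_Diff_subset)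
  finally show ?thesis using dim by (simp add: card_mono of_nat_diff)
qed

text \<open>A vertex is a face of dimension \<open>0\<close>, that is, a subcube without free coordinates.\<close>

lemma cube_vertices_eq: "cube_vertices = {v :: real ^ 'n::finite. \<forall>i. v $ i \<in> {0, 1}}"
proof (intro set_eqI iffI)
  fix v :: "real ^ 'n" assume "v \<in> cube_vertices"
  then have face: "{v} face_of unit_cube" by (simp add: cube_vertices_def face_of_singleton)
  obtain J c where c: "\<And>i. c $ i \<in> {0, 1}" and eq: "{v} = subcube J c"
    using face_of_unit_cube_imp_subcube[OF face] by (metis insert_not_empty)
  have "card J = CARD('n)" using aff_dim_subcube[OF c, of J] by (simp flip: eq)
  then have "J = UNIV" by (simp add: card_eq_UNIV_imp_eq_UNIV)
  then have "v = c" using eq by (auto simp: subcube_def vec_eq_iff)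
  then show "v \<in> {v. \<forall>i. v $ i \<in> {0, 1}}" using c by auto
next
  fix v :: "real ^ 'n" assume "v \<in> {v. \<forall>i. v $ i \<in> {0, 1}}"
  then have v: "\<And>i. v $ i \<in> {0, 1}" by auto
  then have "v \<in> unit_cube" by (rule zero_one_mem_unit_cube)
  then have "subcube UNIV v = {v}" by (auto simp: subcube_def vec_eq_iff)
  then show "v \<in> cube_vertices"
    using subcube_face_of_unit_cube[OF v, of UNIV] by (simp add: cube_vertices_def face_of_singleton)
qed

lemma mem_cube_verticesD: "v \<in> cube_vertices \<Longrightarrow> v $ i \<in> {0, 1}"
  by (auto simp: cube_vertices_eq)

lemma cube_vertices_subset: "cube_vertices \<subseteq> unit_cube"
  by (simp add: cube_vertices_def extreme_point_of_def subset_iff)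

lemma vertex_face_subset: "vertex_face J c \<subseteq> cube_vertices"
  by (auto simp: vertex_face_def)

lemma vertex_face_conv_subcube: "vertex_face J c = cube_vertices \<inter> subcube J c"
  using cube_vertices_subset by (auto simp: vertex_face_def subcube_def)

lemma convex_hull_vertex_face:
  assumes "c \<in> cube_vertices"
  shows "convex hull (vertex_face J c) = subcube J c"
proof -
  have face: "subcube J c face_of unit_cube"
    by (rule subcube_face_of_unit_cube, rule mem_cube_verticesD[OF assms])
  have "compact (subcube J c)"
    using face_of_imp_compact[OF _ _ face] by (simp add: unit_cube_def)
  moreover have "convex (subcube J c)"
    using face by (rule face_of_imp_convex)
  ultimately have "subcube J c = convex hull {v. v extreme_point_of subcube J c}"
    by (rule Krein_Milman_Minkowski)
  also have "{v. v extreme_point_of subcube J c} = vertex_face J c"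
    using extreme_point_of_face[OF face]
    by (auto simp: vertex_face_conv_subcube cube_vertices_def)
  finally show ?thesis by simp
qed

text \<open>
  A set of vertices is recovered from its convex hull as the set of extreme points. The faces of
  codimension \<open>k\<close> thus correspond to the ways of fixing \<open>k\<close> coordinates.
\<close>

lemma Cube_hyperedges:
  assumes "k \<le> CARD('n::finite)"
  shows "Cube TYPE('n) (CARD('n) - k) =
    (cube_vertices, {vertex_face J c | J c. card J = k \<and> c \<in> cube_vertices})"
proof -
  have "h \<subseteq> cube_vertices \<and> convex hull h face_of unit_cube
          \<and> aff_dim (convex hull h) = int (CARD('n) - k) \<longleftrightarrow>
        (\<exists>J c. h = vertex_face J c \<and> card J = k \<and> c \<in> cube_vertices)"
    (is "?face h \<longleftrightarrow> ?vf h") for h :: "(real ^ 'n) set"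
  proof
    assume h: "?face h"
    then have "aff_dim (convex hull h) \<noteq> -1" by simp
    then have "convex hull h \<noteq> {}" by (simp only: aff_dim_empty not_False_eq_True)
    then obtain J c where c: "\<And>i. c $ i \<in> {0, 1}" and eq: "convex hull h = subcube J c"
      using h face_of_unit_cube_imp_subcube by metis
    have "h = vertex_face J c"
    proof
      show "h \<subseteq> vertex_face J c"
        using h hull_subset[of h convex] eq by (auto simp: vertex_face_conv_subcube)
      show "vertex_face J c \<subseteq> h"
      proof
        fix v assume "v \<in> vertex_face J c"
        then have "v extreme_point_of convex hull h"
          using extreme_point_of_face[of "convex hull h" unit_cube v] h eq
          by (auto simp: vertex_face_conv_subcube cube_vertices_def)
        then show "v \<in> h" by (rule extreme_point_of_convex_hull)
      qed
    qed
    moreover have "card J = k"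
      using aff_dim_subcube[OF c, of J] h eq assms by (simp add: of_nat_diff)
    moreover have "c \<in> cube_vertices" using c by (auto simp: cube_vertices_eq)
    ultimately show "?vf h" by blast
  next
    assume "?vf h"
    then obtain J c where h: "h = vertex_face J c" "card J = k" and c: "c \<in> cube_vertices" by auto
    then show "?face h"
      using subcube_face_of_unit_cube[OF mem_cube_verticesD[OF c], of J]
        aff_dim_subcube[OF mem_cube_verticesD[OF c], of J] assms
      by (simp add: convex_hull_vertex_face[OF c] of_nat_diff vertex_face_subset)
  qed
  then show ?thesis by (auto simp: Cube_def)
qed

section \<open>Permuting the coordinates\<close>

definition permute_coords :: "('n \<Rightarrow> 'n) \<Rightarrow> real ^ 'n \<Rightarrow> real ^ 'n::finite" where
  "permute_coords \<pi> v = (\<chi> i. v $ \<pi> i)"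

lemma permute_coords_nth [simp]: "permute_coords \<pi> v $ i = v $ \<pi> i"
  by (simp add: permute_coords_def)

lemma funpow_permute_coords_nth: "(permute_coords \<pi> ^^ k) v $ i = v $ (\<pi> ^^ k) i"
  by (induction k arbitrary: i) (simp_all add: funpow_swap1[of \<pi>])

lemma permute_coords_inv:
  assumes "bij \<pi>"
  shows "permute_coords \<pi> (permute_coords (inv \<pi>) v) = v"
    and "permute_coords (inv \<pi>) (permute_coords \<pi> v) = v"
  using assms by (simp_all add: vec_eq_iff bij_is_inj bij_is_surj surj_f_inv_f)

lemma inj_permute_coords: "bij \<pi> \<Longrightarrow> inj (permute_coords \<pi>)"
  by (metis injI permute_coords_inv(2))

lemma permute_coords_in_cube_vertices: "v \<in> cube_vertices \<Longrightarrow> permute_coords \<pi> v \<in> cube_vertices"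
  by (simp add: cube_vertices_eq)

lemma permute_coords_image_vertex_face:
  assumes "bij \<pi>"
  shows "permute_coords \<pi> ` vertex_face J c = vertex_face (inv \<pi> ` J) (permute_coords \<pi> c)"
    (is "?l = ?r")
proof
  show "?l \<subseteq> ?r"
    using assms by (auto simp: vertex_face_def permute_coords_in_cube_vertices bij_is_surj surj_f_inv_f)
  show "?r \<subseteq> ?l"
  proof
    fix w assume "w \<in> ?r"
    then have "permute_coords (inv \<pi>) w \<in> vertex_face J c"
      using assms by (auto simp: vertex_face_def permute_coords_in_cube_vertices bij_is_surj surj_f_inv_f)
    then show "w \<in> ?l"
      using permute_coords_inv(1)[OF assms, of w] by (metis image_eqI)
  qed
qed

lemma permute_coords_image_cube_vertices:
  "bij \<pi> \<Longrightarrow> permute_coords \<pi> ` cube_vertices = cube_vertices"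
  using permute_coords_image_vertex_face[of \<pi> "{}" 0] by (simp add: vertex_face_def)

section \<open>The majority vote of an orbit\<close>

text \<open>
  The coordinatewise majority of the vertices obtained from \<open>v\<close> by applying a permutation of the
  coordinates \<open>0, \<dots>, p - 1\<close> times. For odd \<open>p\<close> there are no ties.
\<close>

definition majority :: "nat \<Rightarrow> ('n \<Rightarrow> 'n) \<Rightarrow> real ^ 'n \<Rightarrow> real ^ 'n::finite" where
  "majority p \<pi> v = (\<chi> i. of_bool (real p / 2 < (\<Sum>k<p. v $ (\<pi> ^^ k) i)))"

lemma majority_in_cube_vertices: "majority p \<pi> v \<in> cube_vertices"
  by (simp add: cube_vertices_eq majority_def)

text \<open>Both sides count the same orbit, starting from different points.\<close>

lemma majority_invariant:
  assumes "\<pi> ^^ p = id"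
  shows "majority p \<pi> v $ \<pi> i = majority p \<pi> v $ i"
proof -
  have "(\<Sum>k<p. v $ (\<pi> ^^ k) (\<pi> i)) + v $ i = (\<Sum>k<Suc p. v $ (\<pi> ^^ k) i)"
    by (subst sum.lessThan_Suc_shift) (simp add: funpow_swap1)
  also have "\<dots> = (\<Sum>k<p. v $ (\<pi> ^^ k) i) + v $ i"
    using assms by (simp del: funpow.simps)
  finally show ?thesis by (simp add: majority_def)
qed

lemma majority_agrees:
  assumes v: "v \<in> cube_vertices" and "odd p" and a: "majority p \<pi> v $ i = a"
  shows "real p / 2 < (\<Sum>k<p. of_bool (v $ (\<pi> ^^ k) i = a))"
proof (cases "real p / 2 < (\<Sum>k<p. v $ (\<pi> ^^ k) i)")
  case True
  then have "a = 1" using a by (simp add: majority_def)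
  then have "of_bool (v $ j = a) = v $ j" for j
    using mem_cube_verticesD[OF v, of j] by auto
  then show ?thesis using True by simp
next
  case False
  then have "a = 0" using a by (simp add: majority_def)
  then have compl: "of_bool (v $ j = a) = 1 - v $ j" for j
    using mem_cube_verticesD[OF v, of j] by auto
  have "v $ j = of_nat (of_bool (v $ j = 1))" for j
    using mem_cube_verticesD[OF v, of j] by auto
  then have "(\<Sum>k<p. v $ (\<pi> ^^ k) i) = real (\<Sum>k<p. of_bool (v $ (\<pi> ^^ k) i = 1))"
    by (metis (no_types, lifting) of_nat_sum sum.cong)
  moreover have "real p / 2 \<noteq> real n" for n
  proof
    assume "real p / 2 = real n"
    then have "p = 2 * n" by linarith
    then show False using \<open>odd p\<close> by simp
  qed
  ultimately show ?thesis
    using False by (simp add: compl sum_subtractf) (metis linorder_cases)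
qed

text \<open>
  Two majorities among \<open>p\<close> voters have a voter in common. This is where codimension \<open>2\<close> enters:
  three majorities may have empty intersection.
\<close>

lemma majority_in_vertex_face:
  assumes v: "v \<in> cube_vertices" and p: "odd p" and J: "card J = 2"
    and maj: "majority p \<pi> v \<in> vertex_face J c"
  shows "\<exists>k<p. (permute_coords \<pi> ^^ k) v \<in> vertex_face J c"
proof -
  obtain i j where ij: "J = {i, j}" using J by (auto simp: card_2_iff)
  \<comment> \<open>Adding up both counts, the average over \<open>k\<close> exceeds \<open>1\<close>, so some \<open>k\<close> is counted twice.\<close>
  have "real p < (\<Sum>k<p. of_bool (v $ (\<pi> ^^ k) i = c $ i) + of_bool (v $ (\<pi> ^^ k) j = c $ j))"
    using majority_agrees[OF v p, of \<pi> i] majority_agrees[OF v p, of \<pi> j] maj ij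
    by (simp add: vertex_face_def sum.distrib)
  moreover have "real p = (\<Sum>k<p. 1)" by simp
  ultimately obtain k where k: "k < p"
    "1 < (of_bool (v $ (\<pi> ^^ k) i = c $ i) + of_bool (v $ (\<pi> ^^ k) j = c $ j) :: real)"
    by (metis (no_types, lifting) lessThan_iff not_less sum_mono)
  have "(permute_coords \<pi> ^^ k) v \<in> cube_vertices"
    using v by (induction k) (simp_all add: permute_coords_in_cube_vertices)
  then show ?thesis
    using k ij by (auto simp: vertex_face_def funpow_permute_coords_nth of_bool_def split: if_splits)
qed

section \<open>Cancellation of the invariant covers\<close>

definition cube_ridges :: "(real ^ 'n::finite) set set" where
  "cube_ridges = {vertex_face J c | J c. card J = 2 \<and> c \<in> cube_vertices}"

text \<open>
  The ridges on which the coordinates step from \<open>0\<close> at \<open>i\<close> to \<open>1\<close> at \<open>\<pi> i\<close>, where \<open>A\<close> is meant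
  to be a union of nontrivial cycles of \<open>\<pi>\<close>. They contain no vertex whose coordinates are invariant
  under \<open>\<pi>\<close>, and \<open>\<pi>\<close> permutes them among themselves.
\<close>

definition ascents :: "('n \<Rightarrow> 'n) \<Rightarrow> 'n set \<Rightarrow> (real ^ 'n::finite) set set" where
  "ascents \<pi> A = (\<lambda>i. vertex_face {i, \<pi> i} (axis (\<pi> i) 1)) ` A"

lemma mem_ascent_face:
  assumes "\<pi> i \<noteq> i"
  shows "v \<in> vertex_face {i, \<pi> i} (axis (\<pi> i) 1) \<longleftrightarrow> v \<in> cube_vertices \<and> v $ i = 0 \<and> v $ \<pi> i = 1"
  using assms by (auto simp: vertex_face_def axis_def)

lemma axis_in_cube_vertices: "axis i 1 \<in> cube_vertices"
  by (simp add: cube_vertices_eq axis_def)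

lemma cube_ridges_subset: "cube_ridges \<subseteq> Pow cube_vertices"
  using vertex_face_subset by (auto simp: cube_ridges_def)

lemma finite_cube_ridges: "finite cube_ridges"
  using cube_ridges_subset finite_cube_vertices by (meson finite_Pow_iff finite_subset)

lemma ascents_subset_cube_ridges:
  assumes "\<And>i. i \<in> A \<Longrightarrow> \<pi> i \<noteq> i"
  shows "ascents \<pi> A \<subseteq> cube_ridges"
proof -
  have "card {i, \<pi> i} = 2" if "i \<in> A" for i using assms[OF that] by auto
  then show ?thesis
    unfolding ascents_def cube_ridges_def using axis_in_cube_vertices by blast
qed

lemma card_ascents:
  assumes "\<And>i. i \<in> A \<Longrightarrow> \<pi> i \<noteq> i"
  shows "card (ascents \<pi> A) = card A"
  unfolding ascents_def
proof (rule card_image, rule inj_onI, rule ccontr)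
  fix i j
  assume ij: "i \<in> A" "j \<in> A" "i \<noteq> j"
    and eq: "vertex_face {i, \<pi> i} (axis (\<pi> i) 1) = vertex_face {j, \<pi> j} (axis (\<pi> j) 1)"
  \<comment> \<open>The vertex whose only vanishing coordinate is \<open>i\<close> tells the two faces apart.\<close>
  define v :: "real ^ 'a" where "v = (\<chi> l. of_bool (l \<noteq> i))"
  have "v \<in> vertex_face {i, \<pi> i} (axis (\<pi> i) 1)"
    using assms[OF ij(1)] by (simp add: mem_ascent_face v_def cube_vertices_eq)
  moreover have "v \<notin> vertex_face {j, \<pi> j} (axis (\<pi> j) 1)"
    using assms[OF ij(2)] ij(3) by (simp add: mem_ascent_face v_def)
  ultimately show False using eq by simp
qed

lemma permute_coords_image_ascents:
  assumes "bij \<pi>" "\<pi> ` A = A"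
  shows "(`) (permute_coords \<pi>) ` ascents \<pi> A = ascents \<pi> A"
proof -
  have inv_A: "inv \<pi> ` A = A"
    using assms by (metis bij_is_inj image_inv_f_f)
  have "permute_coords \<pi> ` vertex_face {i, \<pi> i} (axis (\<pi> i) 1) =
      vertex_face {inv \<pi> i, \<pi> (inv \<pi> i)} (axis (\<pi> (inv \<pi> i)) 1)" for i
  proof -
    have "permute_coords \<pi> (axis (\<pi> i) 1) = axis i 1"
      using bij_is_inj[OF assms(1)] by (auto simp: vec_eq_iff axis_def inj_eq)
    then show ?thesis
      using assms(1) by (simp add: permute_coords_image_vertex_face bij_is_inj bij_is_surj surj_f_inv_f)
  qed
  then have "(`) (permute_coords \<pi>) ` ascents \<pi> A =
      (\<lambda>i. vertex_face {i, \<pi> i} (axis (\<pi> i) 1)) ` inv \<pi> ` A"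
    by (simp add: ascents_def image_image)
  then show ?thesis by (simp add: inv_A ascents_def)
qed

text \<open>
  If an invariant \<open>S\<close> leaves a vertex uncovered, it leaves its whole orbit uncovered, and hence
  also the majority vote of the orbit. The latter is invariant under \<open>\<pi>\<close>, so no ascent ridge
  covers it either.
\<close>

lemma covers_if_covers_with_ascents:
  assumes \<pi>: "bij \<pi>" "\<pi> ^^ p = id" and p: "odd p"
    and A: "\<And>i. i \<in> A \<Longrightarrow> \<pi> i \<noteq> i"
    and S: "S \<subseteq> cube_ridges" "(`) (permute_coords \<pi>) ` S = S"
    and cover: "\<Union>(S \<union> ascents \<pi> A) = cube_vertices"
  shows "\<Union>S = cube_vertices"
proof (rule ccontr)
  assume "\<Union>S \<noteq> cube_vertices"
  then obtain v where v: "v \<in> cube_vertices" "v \<notin> \<Union>S" using cover by blast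
  have orbit: "(permute_coords \<pi> ^^ k) v \<notin> \<Union>S" for k
  proof (induction k)
    case (Suc k)
    have "\<Union>S = permute_coords \<pi> ` \<Union>S" using S(2) by (metis image_Union)
    then show ?case
      using Suc inj_permute_coords[OF \<pi>(1)] by (metis comp_apply funpow.simps(2) inj_image_mem_iff)
  qed (use v in simp)
  let ?m = "majority p \<pi> v"
  have "?m \<notin> \<Union>S"
  proof
    assume "?m \<in> \<Union>S"
    then obtain J c where "?m \<in> vertex_face J c" "card J = 2" "vertex_face J c \<in> S"
      using S(1) unfolding cube_ridges_def by blast
    then show False using majority_in_vertex_face[OF v(1) p] orbit by blast
  qed
  moreover have "?m \<notin> \<Union>(ascents \<pi> A)"
    using A majority_invariant[OF \<pi>(2), of v] by (auto simp: ascents_def mem_ascent_face)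
  ultimately show False using cover majority_in_cube_vertices by blast
qed

lemma minus_one_power_card_sym_diff:
  assumes "finite S" "finite D"
  shows "(-1) ^ card (sym_diff S D) = ((-1) ^ card S * (-1) ^ card D :: int)"
proof -
  have "card (sym_diff S D) = card (S - D) + card (D - S)"
    using assms by (intro card_Un_disjoint) auto
  moreover have "card S = card (S - D) + card (S \<inter> D)" "card D = card (D - S) + card (S \<inter> D)"
    using assms by (metis add.commute card_Diff_subset_Int card_Int_Diff finite_Int Int_commute)+
  ultimately show ?thesis by (simp add: power_add minus_one_power_iff)
qed

text \<open>
  Toggling the ascent ridges, \<open>S \<mapsto> sym_diff S (ascents \<pi> A)\<close>, is an involution on the invariant
  covers. It reverses the sign because the number of ascent ridges is odd.
\<close>

lemma sum_invariant_covers_eq_0: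
  assumes \<pi>: "bij \<pi>" "\<pi> ^^ p = id" and p: "odd p"
    and A: "\<And>i. i \<in> A \<Longrightarrow> \<pi> i \<noteq> i" "\<pi> ` A = A" "odd (card A)"
  shows "(\<Sum>S | S \<subseteq> cube_ridges \<and> \<Union>S = cube_vertices \<and> (`) (permute_coords \<pi>) ` S = S.
            (-1) ^ card S) = (0::int)" (is "sum _ ?C = 0")
proof -
  let ?D = "ascents \<pi> A"
  let ?T = "(`) (permute_coords \<pi>)"
  note D = ascents_subset_cube_ridges[of A \<pi>, OF A(1)] card_ascents[of A \<pi>, OF A(1)]
    permute_coords_image_ascents[OF \<pi>(1) A(2)]
  have inj: "inj ?T" using inj_permute_coords[OF \<pi>(1)] by (simp add: inj_def inj_image_eq_iff)
  have toggle: "sym_diff S ?D \<in> ?C" if "S \<in> ?C" for S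
  proof -
    have S: "S \<subseteq> cube_ridges" "\<Union>S = cube_vertices" "?T ` S = S" using that by auto
    have sub: "sym_diff S ?D \<subseteq> cube_ridges" using S(1) D(1) by blast
    have inv: "?T ` sym_diff S ?D = sym_diff S ?D"
      using S(3) D(3) inj by (simp add: image_Un image_set_diff)
    have cover: "\<Union>(sym_diff S ?D \<union> ?D) = cube_vertices"
    proof -
      have "sym_diff S ?D \<union> ?D = S \<union> ?D" by blast
      then show ?thesis using S(2) D(1) cube_ridges_subset by fastforce
    qed
    have "\<Union>(sym_diff S ?D) = cube_vertices"
      using covers_if_covers_with_ascents[OF \<pi> p A(1) sub inv cover] by simp
    then show ?thesis using sub inv by simp
  qed
  have "sum (\<lambda>S. (-1) ^ card S) ?C = sum (\<lambda>S. - ((-1) ^ card S) :: int) ?C"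
  proof (rule sum.reindex_bij_witness[of _ "\<lambda>S. sym_diff S ?D" "\<lambda>S. sym_diff S ?D"])
    fix S assume S: "S \<in> ?C"
    then have "finite S" "finite ?D" using finite_cube_ridges D(1) by (auto intro: finite_subset)
    then show "- ((-1) ^ card (sym_diff S ?D)) = ((-1) ^ card S :: int)"
      using D(2) A(3) by (simp add: minus_one_power_card_sym_diff)
  qed (use toggle in auto)
  then show ?thesis by (simp add: sum_negf)
qed

lemma ex_cyclic_permutation:
  assumes "2 \<le> p" "p \<le> CARD('n)"
  obtains \<pi> :: "'n::finite \<Rightarrow> 'n" and A
  where "bij \<pi>" "\<pi> ^^ p = id" "\<pi> ` A = A" "card A = p" "\<And>i. i \<in> A \<Longrightarrow> \<pi> i \<noteq> i"
proof -
  obtain A :: "'n set" where A: "card A = p"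
    using obtain_subset_with_card_n[OF assms(2)] by auto
  obtain cs where cs: "set cs = A" "distinct cs"
    using finite_distinct_list[of A] by auto
  then have len: "length cs = p" using A distinct_card by fastforce
  let ?\<pi> = "cycle_of_list cs"
  have rot: "map (?\<pi> ^^ k) cs = rotate k cs" for k using cyclic_rotation[OF cs(2)] .
  have perm: "?\<pi> permutes A" using cycle_permutes[of cs] cs(1) by simp
  have "?\<pi> ^^ p = id"
  proof
    fix i
    show "(?\<pi> ^^ p) i = id i"
    proof (cases "i \<in> A")
      case True
      have "map (?\<pi> ^^ p) cs = map id cs" using rot[of p] len by simp
      then show ?thesis using True cs(1) by (simp only: map_eq_conv)
    next
      case False
      then have "?\<pi> i = i" using cs(1) by (simp add: id_outside_supp)
      then show ?thesis by (induction p) auto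
    qed
  qed
  moreover have "?\<pi> i \<noteq> i" if "i \<in> A" for i
  proof -
    obtain k where k: "k < p" "i = cs ! k" using \<open>i \<in> A\<close> cs(1) len by (metis in_set_conv_nth)
    have "?\<pi> i = cs ! (Suc k mod p)"
      using arg_cong[OF rot[of 1], of "\<lambda>xs. xs ! k"] k len by (simp add: nth_rotate1)
    moreover have "Suc k mod p < p" "Suc k mod p \<noteq> k"
      using k assms(1) by (auto simp: mod_Suc)
    ultimately show ?thesis using cs(2) k len by (simp add: nth_eq_iff_index_eq)
  qed
  ultimately show ?thesis
    using that[of ?\<pi> A] perm A by (simp add: permutes_bij permutes_image)
qed

section \<open>The Euler characteristic modulo an odd prime\<close>

theorem theorem9:
  fixes p n :: nat
  assumes "prime p" and "odd p"
    and "CARD('n::finite) = n" and "n \<ge> p"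
  shows "[euler_char (Theta (Cube TYPE('n) (n - 2))) = 1] (mod int p)"
proof -
  let ?V = "cube_vertices :: (real ^ 'n) set"
  let ?H = "cube_ridges :: (real ^ 'n) set set"
  let ?C = "{S. S \<subseteq> ?H \<and> \<Union>S = ?V}"
  have "2 \<le> p" using assms(1) by (rule prime_ge_2_nat)
  then have Cube: "Cube TYPE('n) (n - 2) = (?V, ?H)"
    using Cube_hyperedges[where 'n = 'n, of 2] assms(3,4) by (simp add: cube_ridges_def)
  obtain \<pi> :: "'n \<Rightarrow> 'n" and A where \<pi>: "bij \<pi>" "\<pi> ^^ p = id" "\<pi> ` A = A"
    and A: "card A = p" "\<And>i. i \<in> A \<Longrightarrow> \<pi> i \<noteq> i"
    using ex_cyclic_permutation[of p, where 'n = 'n] \<open>2 \<le> p\<close> assms(3,4) by metis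
  let ?T = "permute_coords \<pi>"
  have "A \<noteq> {}" using A(1) \<open>2 \<le> p\<close> by auto
  then have "ascents \<pi> A \<noteq> {}" by (simp add: ascents_def)
  then have "?H \<noteq> {}" using ascents_subset_cube_ridges[of A \<pi>, OF A(2)] by blast
  then have euler: "euler_char (Theta (?V, ?H)) = 1 + (\<Sum>S\<in>?C. (-1) ^ card S)"
    using cube_ridges_subset finite_cube_vertices zero_in_cube_vertices
    by (intro euler_char_Theta_conv_covers) auto
  have T_V: "?T ` ?V = ?V" using \<pi>(1) by (rule permute_coords_image_cube_vertices)
  have T_H: "?T ` h \<in> ?H" if hH: "h \<in> ?H" for h
  proof -
    obtain J c where h: "h = vertex_face J c" "card J = 2" "c \<in> ?V"
      using hH by (auto simp: cube_ridges_def)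
    have "card (inv \<pi> ` J) = 2"
      using h(2) bij_is_inj[OF bij_imp_bij_inv[OF \<pi>(1)]]
      by (metis card_image inj_on_subset subset_UNIV)
    then show ?thesis
      using h(1,3) permute_coords_in_cube_vertices
      by (auto simp: cube_ridges_def permute_coords_image_vertex_face[OF \<pi>(1)])
  qed
  have "[(\<Sum>S\<in>?C. (-1) ^ card S) = (\<Sum>S\<in>{S \<in> ?C. (`) ?T ` S = S}. (-1) ^ card S)] (mod int p)"
  proof (rule sum_cong_sum_fixpoints[OF assms(1)])
    have "finite (Pow ?H)" using finite_cube_ridges by simp
    then show "finite ?C" by (rule rev_finite_subset) auto
    show "(`) ((`) ?T) ` ?C \<subseteq> ?C"
    proof clarify
      fix S assume S: "S \<subseteq> ?H" "\<Union>S = ?V"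
      have "\<Union>((`) ?T ` S) = ?T ` \<Union>S" by blast
      then show "(`) ?T ` S \<subseteq> ?H \<and> \<Union>((`) ?T ` S) = ?V" using S T_H T_V by auto
    qed
    fix S :: "(real ^ 'n) set set"
    have image_funpow: "((`) f ^^ k) X = (f ^^ k) ` X" for f :: "'b \<Rightarrow> 'b" and k X
      by (induction k) (auto simp: image_comp)
    have "?T ^^ p = id"
      using \<pi>(2) by (simp add: fun_eq_iff vec_eq_iff funpow_permute_coords_nth)
    then have "(`) ?T ^^ p = id" by (simp add: fun_eq_iff image_funpow)
    then show "((`) ((`) ?T) ^^ p) S = S" by (simp add: image_funpow)
    have "inj ((`) ?T)" using inj_permute_coords[OF \<pi>(1)] by (simp add: inj_def inj_image_eq_iff)
    then show "(-1) ^ card ((`) ?T ` S) = ((-1) ^ card S :: int)"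
      by (metis card_image inj_on_subset subset_UNIV)
  qed
  also have "{S \<in> ?C. (`) ?T ` S = S} =
      {S. S \<subseteq> ?H \<and> \<Union>S = ?V \<and> (`) ?T ` S = S}" by auto
  also have "(\<Sum>S | S \<subseteq> ?H \<and> \<Union>S = ?V \<and> (`) ?T ` S = S. (-1) ^ card S) = (0::int)"
    using A assms(2) by (intro sum_invariant_covers_eq_0[OF \<pi>(1,2) assms(2) _ \<pi>(3)]) auto
  finally show ?thesis
    by (simp add: Cube euler cong_add_lcancel_0)
qed

end
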